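(* Let $q = p^e$ with $p$ an odd prime and $e \ge 3$ an integer, let $r$ be an integer with $0 \le r \le e-1$, and let $$\Gamma_{q,r} = \mathrm{Cay}(\mathbb{Z}_q, \langle [(p-1)^{p^r}] \rangle).$$ Then $\Gamma_{q,r}$ is a connected rotational circulant of degree $2p^{e-r-1}$ that admits $[(p-1)^{p^r}]$ as a complete rotation. The set of fixed points of $[(p-1)^{p^r}]$ is equal to $F = \{[px] \ne [0] : x \in \mathbb{Z}\}$ and is an independent set of $\Gamma_{q,r}$. Moreover, $F$ is not a vertex-cut of $\Gamma_{q,r}$ if and only if $r = 0$.
   Context: $\mathbb{Z}_q$ is the additive group of integers mod $q$, $\mathbb{Z}_q^*$ its group of units acting on $\mathbb{Z}_q$ by multiplication; $\langle [u]\rangle$ denotes the cyclic subgroup of $\mathbb{Z}_q^*$ generated by $[u]$, used as a subset of $\mathbb{Z}_q$. For a group $G$ and $S\subseteq G$ with $1\notin S = S^{-1}$, $\mathrm{Cay}(G,S)$ has vertex set $G$ with $g,h$ adjacent iff $gh^{-1}\in S$; a circulant is a Cayley graph on a cyclic group. A complete rotation of $\mathrm{Cay}(G,S)$ is a group automorphism $\omega$ of $G$ with $S^\omega = S$ permuting $S$ cyclically ($s^{\langle\omega\rangle} = S$ for $s\in S$); rotational means admitting a complete rotation. Here $[u] \in \mathbb{Z}_q^*$ acts as the automorphism $[x]\mapsto [ux]$. With $d = |S|$, a fixed point of a complete rotation $\omega$ is an element $g \ne 1$ of $G$ such that $g^{\omega^i} = g$ for some $i \in \{1,\ldots,d-1\}$.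 A vertex-cut of a graph is a set of vertices whose removal increases the number of connected components.
   Formalization: The equality of the set of fixed points with F is claimed only for r < e−1; at r = e−1 it is false, since d = 2 and the rotation is inversion, which has no fixed points while F is nonempty (e.g. p = 3, e = 3, r = 2). All other claims, including independence of F, cover 0 ≤ r ≤ e−1. *)

theory Defs
  imports
    "HOL-Number_Theory.Residues"
    "HOL-Algebra.Bij"
    "HOL-Algebra.Elementary_Groups"
    "Graph_Theory.Graph_Theory"
begin

section \<open>Cayley graphs\<close>

definition connection_set :: "('a, 'b) monoid_scheme \<Rightarrow> 'a set \<Rightarrow> bool" where
  "connection_set G S \<longleftrightarrow>
     S \<subseteq> carrier G \<and> \<one>\<^bsub>G\<^esub> \<notin> S \<and> (\<lambda>s. inv\<^bsub>G\<^esub> s) ` S = S"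

text \<open>An undirected graph is represented by the symmetric digraph having both arcs
  of every edge; for a connection set this digraph is symmetric and loopless.\<close>

definition Cay :: "('a, 'b) monoid_scheme \<Rightarrow> 'a set \<Rightarrow> 'a pair_pre_digraph" where
  "Cay G S = \<lparr> pverts = carrier G,
     parcs = {(g, h). g \<in> carrier G \<and> h \<in> carrier G \<and> g \<otimes>\<^bsub>G\<^esub> inv\<^bsub>G\<^esub> h \<in> S} \<rparr>"

definition circulant :: "'a pair_pre_digraph \<Rightarrow> bool" where
  "circulant \<Gamma> \<longleftrightarrow> (\<exists>(G :: 'a monoid) S.
     group G \<and> cyclic_group G \<and> connection_set G S \<and> \<Gamma> = Cay G S)"

text \<open>Automorphisms are elements of \<^const>\<open>AutoGroup\<close>, hence extensional functions
  on the carrier.  The last conjunct says that the orbit of every \<open>s \<in> S\<close> under the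
  cyclic group generated by \<open>\<omega>\<close> is \<open>S\<close>.\<close>

definition complete_rotation ::
    "('a, 'b) monoid_scheme \<Rightarrow> 'a set \<Rightarrow> ('a \<Rightarrow> 'a) \<Rightarrow> bool" where
  "complete_rotation G S \<omega> \<longleftrightarrow>
     group G \<and> connection_set G S \<and> \<omega> \<in> auto G \<and> \<omega> ` S = S \<and>
     (\<forall>s\<in>S. (\<lambda>\<phi>. \<phi> s) ` generate (AutoGroup G) {\<omega>} = S)"

definition rotational :: "('a, 'b) monoid_scheme \<Rightarrow> 'a set \<Rightarrow> bool" where
  "rotational G S \<longleftrightarrow> (\<exists>\<omega>. complete_rotation G S \<omega>)"

text \<open>Only the powers \<open>\<omega>\<^sup>i\<close> with \<open>1 \<le> i \<le> card S - 1\<close> count.  In particular, for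
  \<open>card S = 2\<close> only \<open>\<omega>\<close> itself does, so that inversion on a group of odd order has
  no fixed points.\<close>

definition rotation_fixed_points ::
    "('a, 'b) monoid_scheme \<Rightarrow> 'a set \<Rightarrow> ('a \<Rightarrow> 'a) \<Rightarrow> 'a set" where
  "rotation_fixed_points G S \<omega> =
     {g \<in> carrier G. g \<noteq> \<one>\<^bsub>G\<^esub> \<and>
        (\<exists>i::nat \<in> {1..card S - 1}. (\<omega> [^]\<^bsub>AutoGroup G\<^esub> i) g = g)}"


section \<open>Graph notions\<close>

text \<open>On a symmetric digraph the out-degree is the degree, and the strongly connected
  components are the connected components of the underlying undirected graph.\<close>

definition regular_of_degree :: "'a pair_pre_digraph \<Rightarrow> nat \<Rightarrow> bool" where
  "regular_of_degree \<Gamma> d \<longleftrightarrow> (\<forall>v \<in> pverts \<Gamma>. out_degree (with_proj \<Gamma>) v = d)"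

definition independent_set :: "'a pair_pre_digraph \<Rightarrow> 'a set \<Rightarrow> bool" where
  "independent_set \<Gamma> A \<longleftrightarrow>
     A \<subseteq> pverts \<Gamma> \<and> (\<forall>x\<in>A. \<forall>y\<in>A. (x, y) \<notin> parcs \<Gamma>)"

text \<open>To be used for finite graphs only, because of \<^const>\<open>card\<close>.\<close>

definition vertex_cut :: "'a pair_pre_digraph \<Rightarrow> 'a set \<Rightarrow> bool" where
  "vertex_cut \<Gamma> A \<longleftrightarrow> A \<subseteq> pverts \<Gamma> \<and>
     card (pre_digraph.sccs (with_proj \<Gamma>))
       < card (pre_digraph.sccs (with_proj \<Gamma> \<restriction> (pverts \<Gamma> - A)))"


section \<open>The circulants on the integers modulo a prime power\<close>

text \<open>The class of \<open>k\<close> modulo \<open>q\<close> is represented by \<open>k mod q\<close> in \<^term>\<open>{0..q - 1}\<close>.\<close>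

definition Zq :: "nat \<Rightarrow> int monoid" where
  "Zq q = add_monoid (residue_ring (int q))"

definition unit_action :: "nat \<Rightarrow> int \<Rightarrow> int \<Rightarrow> int" where
  "unit_action q u = (\<lambda>x \<in> carrier (Zq q). (u * x) mod int q)"

definition rotation_unit :: "nat \<Rightarrow> nat \<Rightarrow> nat \<Rightarrow> int" where
  "rotation_unit p e r = ((int p - 1) ^ (p ^ r)) mod int (p ^ e)"

definition rotation_subgroup :: "nat \<Rightarrow> nat \<Rightarrow> nat \<Rightarrow> int set" where
  "rotation_subgroup p e r =
     generate (units_of (residue_ring (int (p ^ e)))) {rotation_unit p e r}"

definition rotation_graph :: "nat \<Rightarrow> nat \<Rightarrow> nat \<Rightarrow> int pair_pre_digraph" where
  "rotation_graph p e r = Cay (Zq (p ^ e)) (rotation_subgroup p e r)"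

definition nonzero_multiples :: "nat \<Rightarrow> nat \<Rightarrow> int set" where
  "nonzero_multiples p q =
     {(int p * x) mod int q | x :: int. (int p * x) mod int q \<noteq> 0}"

end

theory Submission
  imports Defs
begin

text \<open>
  Write \<open>u = (p - 1)^(p^r)\<close> and \<open>m = p^(r + 1)\<close>.  Lifting the exponent, starting from
  \<open>(p - 1)^2 = 1 + p (p - 2)\<close>, shows that \<open>u\<close> has order \<open>2 p^(e - r - 1)\<close> modulo \<open>q\<close>.  Since
  \<open>u\<close> is congruent to \<open>- 1\<close> modulo \<open>m\<close>, its powers lie in the two residue classes of \<open>1\<close> and
  \<open>- 1\<close> modulo \<open>m\<close>, and counting shows that they fill them.  So the graph is the cycle of
  length \<open>m\<close> with every vertex blown up to an independent set of \<open>q / m\<close> vertices, and whether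
  the nonzero multiples of \<open>p\<close> form a vertex-cut can be read off from the cycle.  They are
  fixed by \<open>u^(2 p^(e - r - 2))\<close>, which is congruent to \<open>1\<close> modulo \<open>p^(e - 1)\<close>.
\<close>

section \<open>Powers of integers congruent to one modulo a prime\<close>

text \<open>The binomial expansion truncated after the linear term: all further terms contain
  \<open>y\<^sup>2\<close>, which vanishes modulo \<open>P\<^sup>2\<close>.\<close>

lemma pow_one_plus_cong_square:
  fixes y P :: int
  assumes "P dvd y"
  shows "[(1 + y) ^ i = 1 + int i * y] (mod P\<^sup>2)"
proof (induction i)
  case (Suc i)
  have "[(1 + y) ^ Suc i = (1 + y) * (1 + int i * y)] (mod P\<^sup>2)"
    using cong_mult[OF cong_refl Suc] by simp
  also have "(1 + y) * (1 + int i * y) = 1 + int (Suc i) * y + int i * y\<^sup>2"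
    by (simp add: algebra_simps power2_eq_square)
  also have "[\<dots> = 1 + int (Suc i) * y + 0] (mod P\<^sup>2)"
    using assms by (intro cong_add cong_refl) (simp add: cong_0_iff)
  finally show ?case by simp
qed simp

text \<open>One step of lifting the exponent. Modulo \<open>p\<^sup>2\<close> the geometric sum of
  the powers of \<open>w = 1 + y\<close> is p + y p (p - 1) / 2; since p is odd, (p - 1) / 2 is an
  integer and the second term vanishes. The form \<open>int p * (1 + int p * t)\<close> records that
  exactly one factor p is gained.\<close>

lemma odd_power_minus_one:
  fixes w :: int and p :: nat
  assumes "odd p" and "int p dvd w - 1"
  obtains t where "w ^ p - 1 = (w - 1) * (int p * (1 + int p * t))"
proof -
  define y where "y = w - 1"
  have w: "w = 1 + y" by (simp add: y_def)
  have y: "int p dvd y" using assms(2) by (simp add: y_def)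
  obtain m where m: "p = 2 * m + 1" using assms(1) by (elim oddE)
  have "2 * (\<Sum>i<n. int i) = int n * (int n - 1)" for n
    by (induction n) (auto simp: algebra_simps)
  from this[of p] have gauss: "(\<Sum>i<p. int i) = int p * int m"
    using m by simp
  have "[(\<Sum>i<p. w ^ i) = (\<Sum>i<p. 1 + int i * y)] (mod (int p)\<^sup>2)"
    unfolding w by (intro cong_sum pow_one_plus_cong_square y)
  also have "(\<Sum>i<p. 1 + int i * y) = int p + int p * int m * y"
    by (simp add: sum.distrib gauss flip: sum_distrib_right)
  also have "[\<dots> = int p + 0] (mod (int p)\<^sup>2)"
    using y by (intro cong_add cong_refl)
      (auto simp: cong_0_iff power2_eq_square intro!: mult_dvd_mono)
  finally have "(int p)\<^sup>2 dvd (\<Sum>i<p. w ^ i) - int p"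
    by (simp add: cong_iff_dvd_diff)
  then obtain t where "(\<Sum>i<p. w ^ i) - int p = (int p)\<^sup>2 * t" by (elim dvdE)
  then have "(\<Sum>i<p. w ^ i) = int p * (1 + int p * t)"
    by (simp add: algebra_simps power2_eq_square)
  moreover have "w ^ p - 1 = (w - 1) * (\<Sum>i<p. w ^ i)"
    by (simp add: power_diff_1_eq)
  ultimately show ?thesis using that by metis
qed

text \<open>Each p-th power adds exactly one factor p. That \<open>c\<close> is prime to p makes the
  exponent k + 1 exact, so the same lemma bounds the order of \<open>u\<close> from above and from
  below.\<close>

lemma prime_power_power_minus_one:
  fixes w :: int and p :: nat
  assumes "prime p" "odd p" "int p dvd w - 1" "\<not> int p ^ 2 dvd w - 1"
  obtains c where "w ^ (p ^ k) = 1 + int p ^ (k + 1) * c" "\<not> int p dvd c"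
proof -
  have P: "prime (int p)" using assms(1) by simp
  have "\<exists>c. w ^ (p ^ k) = 1 + int p ^ (k + 1) * c \<and> \<not> int p dvd c"
  proof (induction k)
    case 0
    obtain c where c: "w - 1 = int p * c" using assms(3) by (elim dvdE)
    then have "w = 1 + int p * c" by simp
    moreover have "\<not> int p dvd c"
      using assms(4) c by (auto simp: power2_eq_square)
    ultimately show ?case by auto
  next
    case (Suc k)
    then obtain c where c: "w ^ (p ^ k) = 1 + int p ^ (k + 1) * c" "\<not> int p dvd c" by auto
    then have "int p dvd w ^ (p ^ k) - 1" by simp
    then obtain t where t: "(w ^ (p ^ k)) ^ p - 1 = (w ^ (p ^ k) - 1) * (int p * (1 + int p * t))"
      using odd_power_minus_one assms(2) by metis
    have "w ^ (p ^ Suc k) = (w ^ (p ^ k)) ^ p" by (simp add: mult.commute flip: power_mult)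
    also have "\<dots> = 1 + int p ^ (Suc k + 1) * (c * (1 + int p * t))"
      using t c(1) by (simp add: algebra_simps)
    finally have "w ^ (p ^ Suc k) = 1 + int p ^ (Suc k + 1) * (c * (1 + int p * t))" .
    moreover have "\<not> int p dvd 1 + int p * t"
      using P by (metis dvd_add_left_iff dvd_triv_left not_prime_unit)
    then have "\<not> int p dvd c * (1 + int p * t)"
      using c(2) P by (simp add: prime_dvd_mult_iff)
    ultimately show ?case by blast
  qed
  then show ?thesis using that by blast
qed

section \<open>Counting residue classes in an interval\<close>

lemma card_residue_class:
  fixes a m :: int and N :: nat
  assumes "m > 0"
  shows "card {x \<in> {0..<m * int N}. [x = a] (mod m)} = N"
proof -
  have "bij_betw (\<lambda>j. a mod m + m * int j) {..<N} {x \<in> {0..<m * int N}. [x = a] (mod m)}"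
  proof (rule bij_betwI[where g = "\<lambda>x. nat (x div m)"])
    show "(\<lambda>j. a mod m + m * int j) \<in> {..<N} \<rightarrow> {x \<in> {0..<m * int N}. [x = a] (mod m)}"
    proof
      fix j assume "j \<in> {..<N}"
      then have "m * (int j + 1) \<le> m * int N" using assms by (intro mult_left_mono) auto
      then have "m * int j + m \<le> m * int N" by (simp add: distrib_left)
      moreover have "a mod m < m" "0 \<le> a mod m" using assms by auto
      moreover have "0 \<le> m * int j" using assms by simp
      ultimately have "a mod m + m * int j < m * int N" "0 \<le> a mod m + m * int j"
        by linarith+
      then show "a mod m + m * int j \<in> {x \<in> {0..<m * int N}. [x = a] (mod m)}"
        by (simp add: cong_def)
    qed
    show "(\<lambda>x. nat (x div m)) \<in> {x \<in> {0..<m * int N}. [x = a] (mod m)} \<rightarrow> {..<N}"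
    proof
      fix x assume x: "x \<in> {x \<in> {0..<m * int N}. [x = a] (mod m)}"
      then have "m * (x div m) < m * int N"
        using assms by (smt (verit) Euclidean_Rings.pos_mod_sign atLeastLessThan_iff mem_Collect_eq mult_div_mod_eq)
      then have "x div m < int N" using assms by simp
      then show "nat (x div m) \<in> {..<N}" using x assms by (auto simp: nat_less_iff pos_imp_zdiv_nonneg_iff)
    qed
  next
    fix j assume "j \<in> {..<N}"
    show "nat ((a mod m + m * int j) div m) = j" using assms by simp
  next
    fix x assume x: "x \<in> {x \<in> {0..<m * int N}. [x = a] (mod m)}"
    then have "a mod m = x mod m" by (simp add: cong_def)
    moreover have "int (nat (x div m)) = x div m"
      using x assms by (simp add: pos_imp_zdiv_nonneg_iff)
    ultimately show "a mod m + m * int (nat (x div m)) = x" by simp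
  qed
  then show ?thesis by (metis bij_betw_same_card card_lessThan)
qed

text \<open>Used twice: with the classes of 1 and - 1 to count the connection set, and with those of
  v + 1 and v - 1 for the degree of a vertex v.\<close>

lemma card_two_residue_classes:
  fixes a b m :: int and N :: nat
  assumes "m > 0" "\<not> [a = b] (mod m)"
  shows "card {x \<in> {0..<m * int N}. [x = a] (mod m) \<or> [x = b] (mod m)} = 2 * N"
proof -
  let ?A = "\<lambda>a. {x \<in> {0..<m * int N}. [x = a] (mod m)}"
  have "{x \<in> {0..<m * int N}. [x = a] (mod m) \<or> [x = b] (mod m)} = ?A a \<union> ?A b" by auto
  moreover have "?A a \<inter> ?A b = {}" using assms(2) by (auto simp: cong_def)
  moreover have "finite {x \<in> {0..<m * int N}. P x}" for P by (rule finite_subset[of _ "{0..<m * int N}"]) auto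
  ultimately show ?thesis using card_residue_class[OF assms(1)] by (simp add: card_Un_disjoint)
qed


section \<open>Strong components and vertex-cuts\<close>

text \<open>Walks can be reversed in a symmetric digraph, so any two vertices are joined through the
  root \<open>a\<close>.\<close>

lemma (in sym_digraph) strongly_connected_if_all_reachable:
  assumes "a \<in> verts G" and "\<And>v. v \<in> verts G \<Longrightarrow> a \<rightarrow>\<^sup>* v"
  shows "strongly_connected G"
  using assms by (intro strongly_connectedI) (auto intro: reachable_trans symmetric_reachable')

lemma (in wf_digraph) strongly_connected_imp_connected:
  "strongly_connected G \<Longrightarrow> connected G"
  by (auto simp: connected_def strongly_connected_def intro: reachable_mk_symmetricI)

lemma (in fin_digraph) one_less_card_sccs:
  assumes "u \<in> verts G" "v \<in> verts G" "\<not> u \<rightarrow>\<^sup>* v"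
  shows "1 < card sccs"
proof -
  have "scc_of u \<noteq> scc_of v"
    using assms in_scc_of_self[of v] by (auto simp: scc_of_def)
  then have "2 = card {scc_of u, scc_of v}" by simp
  also have "\<dots> \<le> card sccs_verts"
    using assms by (intro card_mono finite_sccs_verts) (auto intro: scc_of_in_sccs_verts)
  finally show ?thesis by (simp add: card_sccs_verts)
qed

lemma arcs_ends_induce_with_proj:
  "arcs_ends (with_proj G \<restriction> V) = {(x, y) \<in> parcs G. x \<in> V \<and> y \<in> V}"
  by (auto simp: arcs_ends_conv image_iff)

text \<open>The whole graph has a single component, so a cut is a set whose removal leaves at least
  two. Some vertex must remain, because the empty graph is not strongly connected although it has no
  components.\<close>

lemma vertex_cut_iff_not_strongly_connected:
  assumes "pair_pseudo_graph G" "strongly_connected (with_proj G)"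
    and "A \<subseteq> pverts G" "A \<noteq> pverts G"
  shows "vertex_cut G A \<longleftrightarrow> \<not> strongly_connected (with_proj G \<restriction> (pverts G - A))"
proof -
  interpret pair_pseudo_graph G by (rule assms(1))
  let ?H = "with_proj G \<restriction> (pverts G - A)"
  have H: "induced_subgraph ?H (with_proj G)" by (rule induced_induce) auto
  interpret H: fin_digraph ?H
    using H fin_digraph_subgraph induced_imp_subgraph by blast
  have "card sccs = 1" using assms(2) by (simp add: strongly_connected_eq_iff)
  moreover have "H.sccs = {?H}" if "strongly_connected ?H"
    using that by (simp add: H.strongly_connected_eq_iff)
  moreover have "1 < card H.sccs" if disconnected: "\<not> strongly_connected ?H"
  proof -
    have "verts ?H \<noteq> {}" using assms(3,4) by auto
    then obtain u v where "u \<in> verts ?H" "v \<in> verts ?H" "\<not> u \<rightarrow>\<^sup>*\<^bsub>?H\<^esub> v"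
      using disconnected unfolding strongly_connected_def by blast
    then show ?thesis by (rule H.one_less_card_sccs)
  qed
  ultimately show ?thesis using assms(3) by (auto simp: vertex_cut_def)
qed

section \<open>Automorphisms of the integers modulo \<open>q\<close>\<close>

lemma (in residues) Units_pow_mod:
  "(x mod m) [^]\<^bsub>units_of R\<^esub> (n::nat) = x ^ n mod m" if "coprime x m"
  using units_of_pow[of "x mod m" n] that m_gt_one by (simp add: pow_cong)

lemma carrier_Zq: "carrier (Zq q) = {0..<int q}"
  by (auto simp: Zq_def residue_ring_def)

lemma one_Zq: "\<one>\<^bsub>Zq q\<^esub> = 0"
  by (simp add: Zq_def residue_ring_def)

lemma mult_Zq: "x \<otimes>\<^bsub>Zq q\<^esub> y = (x + y) mod int q"
  by (simp add: Zq_def residue_ring_def)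

lemma group_Zq:
  assumes "q > 1"
  shows "group (Zq q)"
proof -
  interpret residues "int q" "residue_ring (int q)"
    using assms by unfold_locales simp_all
  show ?thesis unfolding Zq_def by (rule a_group)
qed

lemma inv_Zq:
  assumes "q > 1" "x \<in> carrier (Zq q)"
  shows "inv\<^bsub>Zq q\<^esub> x = (- x) mod int q"
proof -
  interpret residues "int q" "residue_ring (int q)"
    using assms by unfold_locales simp_all
  show ?thesis using res_neg_eq[of x] by (simp add: Zq_def a_inv_def)
qed

lemma cyclic_group_Zq:
  assumes "q > 1"
  shows "cyclic_group (Zq q)"
proof -
  interpret group "Zq q" by (rule group_Zq[OF assms])
  have one: "1 \<in> carrier (Zq q)" using assms by (simp add: carrier_Zq)
  \<comment> \<open>The operation of \<open>Zq\<close> is addition, so powers of the generator 1 are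
    multiples of it.\<close>
  have pow: "1 [^]\<^bsub>Zq q\<^esub> n = int n mod int q" for n :: nat
    by (induction n) (simp_all add: one_Zq mult_Zq mod_simps add.commute)
  have "x \<in> range (\<lambda>n::int. 1 [^]\<^bsub>Zq q\<^esub> n)" if "x \<in> carrier (Zq q)" for x
  proof
    show "x = 1 [^]\<^bsub>Zq q\<^esub> int (nat x)"
      using that pow[of "nat x"] by (simp add: int_pow_int carrier_Zq)
  qed simp
  then have "carrier (Zq q) = range (\<lambda>n::int. 1 [^]\<^bsub>Zq q\<^esub> n)"
    using one int_pow_closed by blast
  then show ?thesis using cyclic_group one by blast
qed

text \<open>Injectivity is cancellation of a unit; surjectivity then follows because the carrier is
  finite.\<close>

lemma unit_action_in_auto:
  assumes "q > 1" "coprime u (int q)"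
  shows "unit_action q u \<in> auto (Zq q)"
proof -
  have inj: "inj_on (unit_action q u) (carrier (Zq q))"
  proof (rule inj_onI)
    fix x y assume xy: "x \<in> carrier (Zq q)" "y \<in> carrier (Zq q)"
      and "unit_action q u x = unit_action q u y"
    then have "[u * x = u * y] (mod int q)" by (simp add: unit_action_def cong_def)
    then have "[x = y] (mod int q)" using assms(2) by (simp add: cong_mult_lcancel)
    then show "x = y" using xy by (simp add: carrier_Zq cong_def)
  qed
  have into: "unit_action q u \<in> carrier (Zq q) \<rightarrow> carrier (Zq q)"
    using assms(1) by (auto simp: unit_action_def carrier_Zq)
  have "bij_betw (unit_action q u) (carrier (Zq q)) (carrier (Zq q))"
    using inj into endo_inj_surj[of "carrier (Zq q)" "unit_action q u"]
    by (auto simp: bij_betw_def carrier_Zq)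
  moreover have "unit_action q u \<in> hom (Zq q) (Zq q)"
    using into assms(1)
    by (intro homI) (auto simp: unit_action_def mult_Zq carrier_Zq mod_simps algebra_simps)
  ultimately show ?thesis
    by (simp add: auto_def Bij_def unit_action_def)
qed

lemma unit_action_pow:
  assumes "q > 1" "coprime u (int q)"
  shows "unit_action q u [^]\<^bsub>AutoGroup (Zq q)\<^esub> (n::nat) = unit_action q (u ^ n)"
proof (induction n)
  case 0
  show ?case by (auto simp: AutoGroup_def BijGroup_def unit_action_def carrier_Zq)
next
  case (Suc n)
  have "unit_action q v \<in> Bij (carrier (Zq q))" if "coprime v (int q)" for v
    using unit_action_in_auto[OF assms(1) that] by (simp add: auto_def)
  then have "unit_action q (u ^ n) \<otimes>\<^bsub>AutoGroup (Zq q)\<^esub> unit_action q u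
      = compose (carrier (Zq q)) (unit_action q (u ^ n)) (unit_action q u)"
    using assms(2) by (simp add: AutoGroup_def BijGroup_def)
  also have "\<dots> = unit_action q (u ^ Suc n)"
    using assms(1)
    by (auto simp: compose_def unit_action_def carrier_Zq mod_simps algebra_simps intro!: restrict_ext)
  finally show ?case using Suc by simp
qed

text \<open>The automorphism group is finite, being a set of extensional functions on a finite
  carrier, so natural exponents already give the whole cyclic group.\<close>

lemma generate_unit_action:
  assumes "q > 1" "coprime u (int q)"
  shows "generate (AutoGroup (Zq q)) {unit_action q u} = range (\<lambda>n. unit_action q (u ^ n))"
proof -
  interpret group "AutoGroup (Zq q)" by (rule group.AutoGroup[OF group_Zq[OF assms(1)]])
  have "carrier (AutoGroup (Zq q)) \<subseteq> (\<Pi>\<^sub>E x\<in>carrier (Zq q). carrier (Zq q))"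
    by (auto simp: AutoGroup_def auto_def Bij_def PiE_def bij_betw_def)
  moreover have "finite (\<Pi>\<^sub>E x\<in>carrier (Zq q). carrier (Zq q))"
    by (intro finite_PiE) (simp_all add: carrier_Zq)
  ultimately have "finite (carrier (AutoGroup (Zq q)))"
    by (rule finite_subset)
  moreover have "unit_action q u \<in> carrier (AutoGroup (Zq q))"
    using unit_action_in_auto[OF assms] by (simp add: AutoGroup_def)
  ultimately show ?thesis
    using generate_pow_on_finite_carrier unit_action_pow[OF assms] by auto
qed

section \<open>The connection set\<close>

text \<open>Here \<open>u\<close> is the integer power itself and not its residue, so that powers of
  p dividing \<open>u ^ n - 1\<close> can be read off exactly. The number \<open>m\<close> is the
  length of the underlying cycle.\<close>

locale rotation =
  fixes p e r q :: nat and u m :: int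
  assumes p: "prime p" "odd p" and r: "r < e"
  defines "q \<equiv> p ^ e" and "u \<equiv> (int p - 1) ^ (p ^ r)" and "m \<equiv> int p ^ (r + 1)"
begin

lemma p_ge_3: "p \<ge> 3"
  using p prime_ge_2_nat[of p] by (cases "p = 2") auto

lemma prime_int_p: "prime (int p)"
  using p(1) by simp

lemma q_gt_1: "q > 1"
  using p_ge_3 r one_less_power[of p e] by (simp add: q_def)

lemma int_q: "int q = m * int (p ^ (e - r - 1))"
proof -
  have "e = (r + 1) + (e - r - 1)" using r by simp
  then have "int q = int p ^ ((r + 1) + (e - r - 1))" by (metis q_def of_nat_power)
  then show ?thesis by (simp add: m_def power_add)
qed

lemma m_dvd_q: "m dvd int q"
  by (simp add: int_q)

lemma p_dvd_m: "int p dvd m"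
  by (simp add: m_def)

lemma p_dvd_q: "int p dvd int q"
  using p_dvd_m m_dvd_q by (rule dvd_trans)

lemma m_ge_3: "m \<ge> 3"
proof -
  have "m > 0" using p_ge_3 by (simp add: m_def)
  then show ?thesis using p_dvd_m p_ge_3 zdvd_imp_le[of "int p" m] by simp
qed

lemma one_not_cong_minus_one: "\<not> [1 = - 1] (mod m)"
  using m_ge_3 zdvd_imp_le[of m 2] by (auto simp: cong_iff_dvd_diff)

lemma coprime_q_iff: "coprime x (int q) \<longleftrightarrow> \<not> int p dvd x"
proof
  assume "coprime x (int q)"
  then show "\<not> int p dvd x"
    using p_dvd_q coprime_common_divisor[of x "int q" "int p"] prime_int_p by auto
next
  assume "\<not> int p dvd x"
  then have "coprime x (int p)" using prime_int_p prime_imp_coprime coprime_commute by blast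
  then show "coprime x (int q)" by (simp add: q_def)
qed

section \<open>Congruences for \<open>u\<close> and its order\<close>

lemma u_cong_p: "[u = - 1] (mod int p)"
proof -
  have "[u = (- 1) ^ (p ^ r)] (mod int p)"
    unfolding u_def by (intro cong_pow) (simp add: cong_iff_dvd_diff)
  then show ?thesis using p(2) by simp
qed

lemma coprime_u: "coprime u (int q)"
proof -
  have "\<not> int p dvd 1" using prime_int_p not_prime_unit by blast
  then have "\<not> int p dvd u"
    using u_cong_p dvd_add_right_iff[of "int p" u 1] by (auto simp: cong_iff_dvd_diff)
  then show ?thesis by (simp add: coprime_q_iff)
qed

text \<open>Squaring turns - 1 into 1 modulo p. As 0 < p - 2 < p, the number p (p - 2) has exactly
  one factor p, and lifting applies with exponent p^(r + k).\<close>

lemma u_square_power: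
  obtains c where "u ^ (2 * p ^ k) = 1 + int p ^ (r + k + 1) * c" "\<not> int p dvd c"
proof -
  have w: "(int p - 1)\<^sup>2 - 1 = int p * (int p - 2)"
    by (simp add: power2_eq_square algebra_simps)
  have "\<not> int p dvd int p - 2"
    using p_ge_3 zdvd_imp_le[of "int p" "int p - 2"] by auto
  then have "\<not> int p ^ 2 dvd (int p - 1)\<^sup>2 - 1"
    unfolding w using p_ge_3 by (simp add: power2_eq_square)
  moreover have "int p dvd (int p - 1)\<^sup>2 - 1" unfolding w by simp
  ultimately obtain c where
    "((int p - 1)\<^sup>2) ^ (p ^ (r + k)) = 1 + int p ^ (r + k + 1) * c" "\<not> int p dvd c"
    using prime_power_power_minus_one[OF p] by blast
  moreover have "((int p - 1)\<^sup>2) ^ (p ^ (r + k)) = u ^ (2 * p ^ k)"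
    by (simp add: u_def power_add mult_ac flip: power_mult)
  ultimately show ?thesis using that by metis
qed

text \<open>The case k = 0 above gives that \<open>m\<close> divides (u - 1) (u + 1). Since p
  divides u + 1 and p > 2, it does not divide u - 1, so all of \<open>m\<close> goes into u +
  1.\<close>

lemma u_cong: "[u = - 1] (mod m)"
proof -
  obtain c where "u ^ (2 * p ^ 0) = 1 + int p ^ (r + 0 + 1) * c" by (rule u_square_power)
  then have "(u - 1) * (u + 1) = m * c"
    by (simp add: m_def power2_eq_square algebra_simps)
  then have "m dvd (u - 1) * (u + 1)" by simp
  moreover have "\<not> int p dvd u - 1"
  proof
    assume "int p dvd u - 1"
    moreover have "int p dvd u + 1" using u_cong_p by (simp add: cong_iff_dvd_diff)
    ultimately have "int p dvd (u + 1) - (u - 1)" by (rule dvd_diff[rotated])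
    then show False using p_ge_3 zdvd_imp_le[of "int p" 2] by simp
  qed
  then have "coprime (u - 1) (int p)"
    using prime_int_p prime_imp_coprime coprime_commute by blast
  then have "coprime m (u - 1)" unfolding m_def using coprime_commute by auto
  ultimately have "m dvd u + 1" by (simp add: coprime_dvd_mult_right_iff)
  then show ?thesis by (simp add: cong_iff_dvd_diff)
qed

sublocale residues "int q" "residue_ring (int q)"
  using q_gt_1 by unfold_locales simp_all

lemma rotation_unit_eq: "rotation_unit p e r = u mod int q"
  by (simp add: rotation_unit_def u_def q_def)

lemma u_mod_carrier: "u mod int q \<in> carrier (units_of (residue_ring (int q)))"
  using mod_in_res_units[OF _ coprime_u] q_gt_1 by (simp add: units_of_carrier)

lemma u_pow_cong_1_iff: "[u ^ n = 1] (mod int q) \<longleftrightarrow> 2 * p ^ (e - r - 1) dvd n"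
  and ord_u: "group.ord (units_of (residue_ring (int q))) (u mod int q) = 2 * p ^ (e - r - 1)"
proof -
  interpret U: group "units_of (residue_ring (int q))" by (rule units_group)
  define D where "D = U.ord (u mod int q)"
  have D: "[u ^ n = 1] (mod int q) \<longleftrightarrow> D dvd n" for n
  proof -
    have "(u mod int q) [^]\<^bsub>units_of (residue_ring (int q))\<^esub> n = \<one>\<^bsub>units_of (residue_ring (int q))\<^esub>
      \<longleftrightarrow> [u ^ n = 1] (mod int q)"
      using q_gt_1 by (simp add: Units_pow_mod coprime_u units_of_one res_one_eq cong_def)
    then show ?thesis using U.pow_eq_id[OF u_mod_carrier, of n] by (simp add: D_def)
  qed
  have "[u ^ (2 * p ^ (e - r - 1)) = 1] (mod int q)"
  proof -
    obtain c where "u ^ (2 * p ^ (e - r - 1)) = 1 + int p ^ (r + (e - r - 1) + 1) * c"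
      by (rule u_square_power)
    then show ?thesis using r by (simp add: cong_iff_dvd_diff q_def)
  qed
  then have D_dvd: "D dvd 2 * p ^ (e - r - 1)" by (simp add: D)
  \<comment> \<open>The factor 2 of the order is visible modulo p, where \<open>u\<close> is - 1;
    what remains of \<open>D\<close> is a power of p.\<close>
  have "[u ^ D = 1] (mod int p)"
    using D[of D] by (intro cong_dvd_modulus[OF _ p_dvd_q]) simp
  moreover have "[u ^ D = (- 1) ^ D] (mod int p)" by (rule cong_pow[OF u_cong_p])
  ultimately have "[(- 1) ^ D = 1] (mod int p)" by (metis cong_sym cong_trans)
  then have "even D"
    using p_ge_3 zdvd_imp_le[of "int p" 2]
    by (cases "even D") (auto simp: cong_iff_dvd_diff)
  then obtain D' where D': "D = 2 * D'" by (elim evenE)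
  then have "D' dvd p ^ (e - r - 1)" using D_dvd by simp
  then obtain j where j: "j \<le> e - r - 1" "D' = p ^ j"
    using divides_primepow_nat[OF p(1)] by blast
  \<comment> \<open>A smaller \<open>j\<close> would leave only r + j + 1 < e factors p in
    \<open>u ^ D - 1\<close>.\<close>
  have "j = e - r - 1"
  proof (rule ccontr)
    assume "j \<noteq> e - r - 1"
    then have "r + j + 2 \<le> e" using j r by linarith
    obtain c where c: "u ^ (2 * p ^ j) = 1 + int p ^ (r + j + 1) * c" "\<not> int p dvd c"
      by (rule u_square_power)
    have "int p ^ (r + j + 2) dvd int p ^ e"
      using \<open>r + j + 2 \<le> e\<close> by (rule le_imp_power_dvd)
    also have "int p ^ e dvd u ^ (2 * p ^ j) - 1"
      using D[of D] by (simp add: D' j cong_iff_dvd_diff q_def)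
    also have "u ^ (2 * p ^ j) - 1 = int p ^ (r + j + 1) * c" using c(1) by simp
    finally have "int p ^ (r + j + 2) dvd int p ^ (r + j + 1) * c" .
    then have "int p ^ (r + j + 1) * int p dvd int p ^ (r + j + 1) * c"
      by (simp add: mult_ac)
    then have "int p dvd c"
      using p_ge_3 by (subst (asm) dvd_mult_cancel_left) auto
    then show False using c(2) by simp
  qed
  then have "D = 2 * p ^ (e - r - 1)" using D' j by simp
  then show "[u ^ n = 1] (mod int q) \<longleftrightarrow> 2 * p ^ (e - r - 1) dvd n"
    "U.ord (u mod int q) = 2 * p ^ (e - r - 1)"
    using D D_def by simp_all
qed

section \<open>The connection set as two residue classes\<close>

abbreviation S where "S \<equiv> rotation_subgroup p e r"

lemma S_eq_range: "S = range (\<lambda>n. u ^ n mod int q)"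
proof -
  interpret U: group "units_of (residue_ring (int q))" by (rule units_group)
  have "U.ord (u mod int q) \<noteq> 0" using ord_u p_ge_3 by simp
  then have "generate (units_of (residue_ring (int q))) {u mod int q}
      = {(u mod int q) [^]\<^bsub>units_of (residue_ring (int q))\<^esub> k | k :: nat. k \<in> UNIV}"
    using U.generate_pow_nat[OF u_mod_carrier] by simp
  then show ?thesis
    unfolding rotation_subgroup_def rotation_unit_eq
    by (auto simp: Units_pow_mod[OF coprime_u] simp flip: q_def)
qed

lemma card_S: "card S = 2 * p ^ (e - r - 1)"
proof -
  interpret U: group "units_of (residue_ring (int q))" by (rule units_group)
  show ?thesis
    using U.generate_pow_card[OF u_mod_carrier]
    by (simp add: rotation_subgroup_def rotation_unit_eq ord_u flip: q_def)
qed

text \<open>Both sides have the same cardinality, so only one inclusion needs an argument.\<close>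

lemma S_eq: "S = {x \<in> {0..<int q}. [x = 1] (mod m) \<or> [x = - 1] (mod m)}" (is "_ = ?T")
proof (rule card_subset_eq)
  show "finite ?T" by (rule finite_subset[of _ "{0..<int q}"]) auto
  show "S \<subseteq> ?T"
  proof
    fix x assume "x \<in> S"
    then obtain n where x: "x = u ^ n mod int q" by (auto simp: S_eq_range)
    have "[x = u ^ n] (mod m)" unfolding x by (rule cong_dvd_modulus[OF _ m_dvd_q]) simp
    also have "[u ^ n = (- 1) ^ n] (mod m)" by (rule cong_pow[OF u_cong])
    finally have "[x = 1] (mod m) \<or> [x = - 1] (mod m)"
      by (cases "even n") simp_all
    then show "x \<in> ?T" using q_gt_1 by (simp add: x)
  qed
  have "card ?T = 2 * p ^ (e - r - 1)"
    unfolding int_q using m_ge_3 one_not_cong_minus_one by (intro card_two_residue_classes) auto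
  then show "card S = card ?T" by (simp add: card_S)
qed

text \<open>Negation swaps the classes of 1 and - 1 modulo \<open>m\<close>, and 0 lies in
  neither.\<close>

lemma connection_set_S: "connection_set (Zq q) S"
proof -
  have zero: "0 \<notin> S"
    using m_ge_3 by (auto simp: S_eq cong_iff_dvd_diff)
  have "(- s) mod int q \<in> S" if "s \<in> S" for s
  proof -
    have "[(- s) mod int q = - s] (mod m)" by (rule cong_dvd_modulus[OF _ m_dvd_q]) simp
    moreover have "[- s = - 1] (mod m) \<or> [- s = 1] (mod m)"
      using that cong_minus_minus_iff[of s 1 m] cong_minus_minus_iff[of s "- 1" m]
      by (auto simp: S_eq)
    ultimately show ?thesis using q_gt_1 by (auto simp: S_eq intro: cong_trans)
  qed
  moreover have sub: "S \<subseteq> carrier (Zq q)" by (auto simp: S_eq carrier_Zq)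
  ultimately have "inv\<^bsub>Zq q\<^esub> s \<in> S" if "s \<in> S" for s
    using that inv_Zq[OF q_gt_1] by auto
  moreover from this have "s \<in> (\<lambda>s. inv\<^bsub>Zq q\<^esub> s) ` S" if "s \<in> S" for s
    using that sub group.inv_inv[OF group_Zq[OF q_gt_1], of s] by (metis imageI subsetD)
  ultimately have "(\<lambda>s. inv\<^bsub>Zq q\<^esub> s) ` S = S" by blast
  then show ?thesis using zero sub by (simp add: connection_set_def one_Zq)
qed

section \<open>Circulants and the complete rotation\<close>

lemma circulant_rotation_graph: "circulant (rotation_graph p e r)"
  unfolding circulant_def rotation_graph_def
  by (intro exI[of _ "Zq q"] exI[of _ S] conjI group_Zq cyclic_group_Zq q_gt_1 connection_set_S)
    (simp add: q_def)

lemma orbit_eq_S: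
  assumes "s \<in> S"
  shows "range (\<lambda>n. (u ^ n * s) mod int q) = S"
proof -
  obtain b where b: "s = u ^ b mod int q" using assms unfolding S_eq_range by (elim rangeE)
  have mult: "(u ^ n * s) mod int q = u ^ (n + b) mod int q" for n
    by (simp add: b mod_mult_right_eq power_add)
  define d where "d = 2 * p ^ (e - r - 1)"
  have d: "d > 0" "[u ^ d = 1] (mod int q)" using p_ge_3 by (simp_all add: d_def u_pow_cong_1_iff)
  have reached: "u ^ a mod int q \<in> range (\<lambda>n. (u ^ n * s) mod int q)" for a
  proof
    \<comment> \<open>Since \<open>s\<close> is \<open>u ^ b\<close>, the exponent wanted is a - b.
      Replacing - b by (d - 1) b keeps it a natural number, and the surplus d b is absorbed by
      \<open>u ^ d = 1\<close> modulo \<open>q\<close>.\<close>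
    have exponent: "a + (d - 1) * b + b = a + d * b" using d(1) by (cases d) auto
    have "[u ^ a * (u ^ d) ^ b = u ^ a * 1 ^ b] (mod int q)"
      by (intro cong_mult cong_pow d cong_refl)
    then show "u ^ a mod int q = (u ^ (a + (d - 1) * b) * s) mod int q"
      unfolding mult exponent by (simp add: cong_def power_add power_mult)
  qed simp
  show ?thesis
  proof (rule subset_antisym)
    show "range (\<lambda>n. (u ^ n * s) mod int q) \<subseteq> S"
      unfolding mult S_eq_range by (intro image_subsetI rangeI)
    show "S \<subseteq> range (\<lambda>n. (u ^ n * s) mod int q)"
      unfolding S_eq_range by (intro image_subsetI reached)
  qed
qed

lemma unit_action_mod: "unit_action q (u mod int q) = unit_action q u"
  by (simp add: unit_action_def mod_mult_left_eq)

lemma complete_rotation_u: "complete_rotation (Zq q) S (unit_action q u)"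
proof -
  have sub: "S \<subseteq> carrier (Zq q)" by (auto simp: S_eq carrier_Zq)
  have "unit_action q u s \<in> S" if "s \<in> S" for s
  proof -
    have "(u ^ 1 * s) mod int q \<in> S" using orbit_eq_S[OF that] by blast
    then show ?thesis using sub that by (auto simp: unit_action_def)
  qed
  moreover have "inj_on (unit_action q u) S"
    using unit_action_in_auto[OF q_gt_1 coprime_u] sub
    by (auto simp: auto_def Bij_def bij_betw_def intro: inj_on_subset)
  moreover have "finite S" using card_S p_ge_3 by (intro card_ge_0_finite) simp
  ultimately have "unit_action q u ` S = S" by (intro endo_inj_surj) auto
  moreover have "(\<lambda>\<phi>. \<phi> s) ` generate (AutoGroup (Zq q)) {unit_action q u} = S" if "s \<in> S" for s
    unfolding generate_unit_action[OF q_gt_1 coprime_u]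
  proof -
    have "(\<lambda>\<phi>. \<phi> s) ` range (\<lambda>n. unit_action q (u ^ n)) = range (\<lambda>n. (u ^ n * s) mod int q)"
      using sub that unfolding image_image by (intro image_cong) (auto simp: unit_action_def)
    then show "(\<lambda>\<phi>. \<phi> s) ` range (\<lambda>n. unit_action q (u ^ n)) = S"
      using orbit_eq_S[OF that] by simp
  qed
  ultimately show ?thesis
    using group_Zq[OF q_gt_1] connection_set_S unit_action_in_auto[OF q_gt_1 coprime_u]
    by (simp add: complete_rotation_def)
qed

section \<open>Fixed points of the rotation\<close>

lemma nonzero_multiples_eq: "nonzero_multiples p q = {x \<in> {0..<int q}. x \<noteq> 0 \<and> int p dvd x}"
proof -
  have "int p dvd (int p * x) mod int q" for x
    using p_dvd_q by (simp add: dvd_mod)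
  moreover have "\<exists>y. x = (int p * y) mod int q" if "x \<in> {0..<int q}" "int p dvd x" for x
    using that by (metis atLeastLessThan_iff dvdE mod_pos_pos_trivial)
  ultimately show ?thesis
    using q_gt_1 by (auto simp: nonzero_multiples_def)
qed

text \<open>If g is prime to p and fixed by \<open>u ^ i\<close>, then the order
  \<open>card S\<close> of \<open>u\<close> divides i, which is too small. The bound on r excludes
  degree 2: for r = e - 1 only i = 1 counts, and \<open>u\<close> is - 1 modulo \<open>q\<close>,
  which fixes no nonzero residue.\<close>

lemma fixed_points_u:
  assumes "r < e - 1"
  shows "rotation_fixed_points (Zq q) S (unit_action q u) = nonzero_multiples p q"
proof -
  have fixed: "(unit_action q u [^]\<^bsub>AutoGroup (Zq q)\<^esub> i) g = g \<longleftrightarrow> int q dvd (u ^ i - 1) * g"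
    if "g \<in> {0..<int q}" for g and i :: nat
  proof -
    have "(u ^ i * g) mod int q = g \<longleftrightarrow> [u ^ i * g = g] (mod int q)"
      using that by (simp add: cong_def)
    also have "\<dots> \<longleftrightarrow> int q dvd (u ^ i - 1) * g"
      by (simp add: cong_iff_dvd_diff algebra_simps)
    finally show ?thesis
      unfolding unit_action_pow[OF q_gt_1 coprime_u]
      using that by (simp add: unit_action_def carrier_Zq)
  qed
  have ex: "(\<exists>i\<in>{1..card S - 1}. int q dvd (u ^ i - 1) * g) \<longleftrightarrow> int p dvd g" for g
  proof
    assume "\<exists>i\<in>{1..card S - 1}. int q dvd (u ^ i - 1) * g"
    then obtain i where "i \<in> {1..card S - 1}" "int q dvd (u ^ i - 1) * g" by blast
    then have i: "0 < i" "i < card S" "int q dvd (u ^ i - 1) * g" by auto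
    show "int p dvd g"
    proof (rule ccontr)
      assume "\<not> int p dvd g"
      then have "coprime (int q) g" using coprime_q_iff coprime_commute by blast
      then have "int q dvd u ^ i - 1" using i(3) by (simp add: coprime_dvd_mult_left_iff)
      then have "card S dvd i" using u_pow_cong_1_iff by (simp add: cong_iff_dvd_diff card_S)
      then show False using i dvd_imp_le by fastforce
    qed
  next
    assume g: "int p dvd g"
    obtain c where c: "u ^ (2 * p ^ (e - r - 2)) = 1 + int p ^ (r + (e - r - 2) + 1) * c"
      by (rule u_square_power)
    \<comment> \<open>As r < e - 1, the natural subtraction is not truncated. The one factor p still
      missing from \<open>q\<close> comes from \<open>g\<close>.\<close>
    have "r + (e - r - 2) + 1 = e - 1" using assms by simp
    then have "u ^ (2 * p ^ (e - r - 2)) - 1 = int p ^ (e - 1) * c"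
      using c by (simp only:)
    then have "int p ^ (e - 1) * int p dvd (u ^ (2 * p ^ (e - r - 2)) - 1) * g"
      using g by (intro mult_dvd_mono) auto
    moreover have "int p ^ (e - 1) * int p = int q"
      using assms by (simp add: q_def flip: power_Suc2)
    ultimately have "int q dvd (u ^ (2 * p ^ (e - r - 2)) - 1) * g" by simp
    moreover have "2 * p ^ (e - r - 2) \<in> {1..card S - 1}"
    proof -
      have "p ^ (e - r - 2) < p ^ (e - r - 1)"
        using assms p_ge_3 by (intro power_strict_increasing) auto
      then have "2 * p ^ (e - r - 2) \<le> card S - 1" unfolding card_S by linarith
      then show ?thesis using p_ge_3 by simp
    qed
    ultimately show "\<exists>i\<in>{1..card S - 1}. int q dvd (u ^ i - 1) * g" by blast
  qed
  show ?thesis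
    unfolding rotation_fixed_points_def nonzero_multiples_eq carrier_Zq one_Zq
    by (intro Collect_cong conj_cong refl) (simp only: fixed ex)
qed

section \<open>The graph\<close>

abbreviation \<Gamma> where "\<Gamma> \<equiv> rotation_graph p e r"

lemma pverts_\<Gamma>: "pverts \<Gamma> = {0..<int q}"
  by (simp add: rotation_graph_def Cay_def carrier_Zq q_def)

text \<open>Because \<open>m\<close> divides \<open>q\<close>, reducing x - y modulo
  \<open>q\<close> does not change its class modulo \<open>m\<close>, and \<open>S\<close> depends
  only on that class.\<close>

lemma parcs_\<Gamma>: "(x, y) \<in> parcs \<Gamma> \<longleftrightarrow>
    x \<in> {0..<int q} \<and> y \<in> {0..<int q} \<and> ([y = x + 1] (mod m) \<or> [y = x - 1] (mod m))"
proof -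
  have "x \<otimes>\<^bsub>Zq q\<^esub> inv\<^bsub>Zq q\<^esub> y \<in> S \<longleftrightarrow> [y = x + 1] (mod m) \<or> [y = x - 1] (mod m)"
    if "y \<in> {0..<int q}" for y
  proof -
    have prod: "x \<otimes>\<^bsub>Zq q\<^esub> inv\<^bsub>Zq q\<^esub> y = (x - y) mod int q"
      using that q_gt_1 by (simp add: mult_Zq inv_Zq carrier_Zq mod_simps)
    have "[(x - y) mod int q = x - y] (mod m)" by (rule cong_dvd_modulus[OF _ m_dvd_q]) simp
    then have "[(x - y) mod int q = c] (mod m) \<longleftrightarrow> [x - y = c] (mod m)" for c
      by (metis cong_sym cong_trans)
    moreover have "[x - y = c] (mod m) \<longleftrightarrow> [y = x - c] (mod m)" for c
    proof -
      have "y - (x - c) = - (x - y - c)" by simp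
      then show ?thesis by (simp only: cong_iff_dvd_diff dvd_minus_iff)
    qed
    ultimately show ?thesis using q_gt_1 by (auto simp: prod S_eq)
  qed
  then show ?thesis
    by (auto simp: rotation_graph_def Cay_def carrier_Zq simp flip: q_def)
qed

lemma pair_pseudo_graph_\<Gamma>: "pair_pseudo_graph \<Gamma>"
proof
  show "finite (pverts \<Gamma>)" by (simp add: pverts_\<Gamma>)
  have "parcs \<Gamma> \<subseteq> {0..<int q} \<times> {0..<int q}" by (auto simp: parcs_\<Gamma>)
  then show "finite (parcs \<Gamma>)" by (rule finite_subset) simp
  have flip: "[x = y + 1] (mod m) \<longleftrightarrow> [y = x - 1] (mod m)" for x y
  proof -
    have "y - (x - 1) = - (x - (y + 1))" by simp
    then show ?thesis by (simp only: cong_iff_dvd_diff dvd_minus_iff)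
  qed
  show "symmetric (with_proj \<Gamma>)"
    unfolding symmetric_def with_proj_simps by (rule symI) (auto simp only: parcs_\<Gamma> flip)
next
  fix a assume "a \<in> parcs \<Gamma>"
  then show "fst a \<in> pverts \<Gamma>" "snd a \<in> pverts \<Gamma>"
    by (cases a; simp add: parcs_\<Gamma> pverts_\<Gamma>)+
qed

lemma regular_\<Gamma>: "regular_of_degree \<Gamma> (2 * p ^ (e - r - 1))"
  unfolding regular_of_degree_def
proof
  fix v assume v: "v \<in> pverts \<Gamma>"
  let ?N = "{y \<in> {0..<int q}. [y = v + 1] (mod m) \<or> [y = v - 1] (mod m)}"
  have "out_arcs (with_proj \<Gamma>) v = Pair v ` ?N"
    using v by (auto simp: out_arcs_def parcs_\<Gamma> pverts_\<Gamma>)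
  then have "out_degree (with_proj \<Gamma>) v = card ?N"
    by (simp add: out_degree_def card_image inj_on_def)
  also have "\<dots> = 2 * p ^ (e - r - 1)"
    unfolding int_q using m_ge_3 one_not_cong_minus_one
    by (intro card_two_residue_classes) (auto simp: cong_iff_dvd_diff)
  finally show "out_degree (with_proj \<Gamma>) v = 2 * p ^ (e - r - 1)" .
qed

text \<open>Consecutive residues are adjacent, so 0, 1, 2, ... is a walk through all
  vertices.\<close>

lemma strongly_connected_\<Gamma>: "strongly_connected (with_proj \<Gamma>)"
proof -
  interpret G: pair_pseudo_graph \<Gamma> by (rule pair_pseudo_graph_\<Gamma>)
  have reach: "int n < int q \<Longrightarrow> 0 \<rightarrow>\<^sup>*\<^bsub>\<Gamma>\<^esub> int n" for n
  proof (induction n)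
    case 0
    then show ?case by (simp add: pverts_\<Gamma>)
  next
    case (Suc n)
    then have "0 \<rightarrow>\<^sup>*\<^bsub>\<Gamma>\<^esub> int n" by simp
    moreover have "(int n, int (Suc n)) \<in> parcs \<Gamma>"
      using Suc.prems by (simp add: parcs_\<Gamma> add.commute)
    ultimately show ?case by (rule G.reachable_adj_trans)
  qed
  show ?thesis
  proof (rule G.strongly_connected_if_all_reachable)
    show "0 \<in> pverts \<Gamma>" using q_gt_1 by (simp add: pverts_\<Gamma>)
    show "0 \<rightarrow>\<^sup>*\<^bsub>\<Gamma>\<^esub> v" if "v \<in> pverts \<Gamma>" for v
      using reach[of "nat v"] that by (simp add: pverts_\<Gamma>)
  qed
qed

lemma connected_\<Gamma>: "connected (with_proj \<Gamma>)"
proof -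
  interpret G: pair_pseudo_graph \<Gamma> by (rule pair_pseudo_graph_\<Gamma>)
  show ?thesis using strongly_connected_\<Gamma> by (rule G.strongly_connected_imp_connected)
qed

text \<open>Adjacent vertices differ by 1 or - 1 modulo p, as p divides \<open>m\<close>.\<close>

lemma independent_nonzero_multiples: "independent_set \<Gamma> (nonzero_multiples p q)"
proof -
  have "(x, y) \<notin> parcs \<Gamma>" if "int p dvd x" "int p dvd y" for x y
  proof
    assume "(x, y) \<in> parcs \<Gamma>"
    then have "[y = x + 1] (mod int p) \<or> [y = x - 1] (mod int p)"
      using p_dvd_m by (auto simp: parcs_\<Gamma> intro: cong_dvd_modulus)
    then have "int p dvd y - (x + 1) \<or> int p dvd y - (x - 1)"
      by (simp add: cong_iff_dvd_diff)
    moreover have "int p dvd y - x" using that by simp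
    ultimately have "int p dvd (y - x) - (y - (x + 1)) \<or> int p dvd (y - (x - 1)) - (y - x)"
      using dvd_diff by blast
    then show False using p_ge_3 by simp
  qed
  then show ?thesis
    by (auto simp: independent_set_def nonzero_multiples_eq pverts_\<Gamma>)
qed

section \<open>Deleting the nonzero multiples of p\<close>

lemma vertices_left: "pverts \<Gamma> - nonzero_multiples p q = {x \<in> {0..<int q}. int p dvd x \<longrightarrow> x = 0}"
  by (auto simp: pverts_\<Gamma> nonzero_multiples_eq)

lemma sym_digraph_left: "sym_digraph (with_proj \<Gamma> \<restriction> (pverts \<Gamma> - nonzero_multiples p q))"
proof -
  interpret G: pair_pseudo_graph \<Gamma> by (rule pair_pseudo_graph_\<Gamma>)
  show ?thesis by (rule G.induced_graph_imp_graph, rule G.induced_induce) auto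
qed

text \<open>Now \<open>m\<close> is p. The surviving vertex 0 is adjacent to the whole class of 1,
  and from there the classes 2, ..., p - 1 are reached one after another.\<close>

lemma strongly_connected_left:
  assumes "r = 0"
  shows "strongly_connected (with_proj \<Gamma> \<restriction> (pverts \<Gamma> - nonzero_multiples p q))"
    (is "strongly_connected ?H")
proof -
  interpret H: sym_digraph ?H by (rule sym_digraph_left)
  have m: "m = int p" using assms by (simp add: m_def)
  have arc: "x \<rightarrow>\<^bsub>?H\<^esub> y" if "x \<in> verts ?H" "y \<in> verts ?H" "[y = x + 1] (mod m)" for x y
    using that by (auto simp: arcs_ends_induce_with_proj parcs_\<Gamma> pverts_\<Gamma>)
  have zero: "0 \<in> verts ?H" using q_gt_1 by (simp add: vertices_left)
  \<comment> \<open>The induction is on the residue of y, with y arbitrary. The predecessor y - 1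
    has a nonzero residue, so it was not deleted.\<close>
  have reach: "y \<in> verts ?H \<Longrightarrow> y mod int p = int (Suc j) \<Longrightarrow> 0 \<rightarrow>\<^sup>*\<^bsub>?H\<^esub> y" for j y
  proof (induction j arbitrary: y)
    case 0
    then have "[y = 0 + 1] (mod m)" using p_ge_3 by (simp add: m cong_def)
    then show ?case using arc[OF zero 0(1)] by blast
  next
    case (Suc j)
    have "int (Suc (Suc j)) < int p"
      using Suc.prems(2) pos_mod_bound[of "int p" y] p_ge_3 by linarith
    moreover have "[y - 1 = int (Suc j)] (mod int p)"
    proof -
      have "[y = int (Suc (Suc j))] (mod int p)" 
        using mod_mod_trivial[of y "int p"] by (simp only: Suc.prems(2) cong_def)
      then have "[y - 1 = int (Suc (Suc j)) - 1] (mod int p)" by (intro cong_diff cong_refl)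
      then show ?thesis by simp
    qed
    ultimately have mod: "(y - 1) mod int p = int (Suc j)" by (simp add: cong_def)
    then have "\<not> int p dvd y - 1" by (auto simp: dvd_eq_mod_eq_0)
    moreover have "y \<noteq> 0" using Suc.prems(2) by auto
    ultimately have "y - 1 \<in> verts ?H" using Suc.prems(1) by (auto simp: vertices_left)
    moreover from this have "0 \<rightarrow>\<^sup>*\<^bsub>?H\<^esub> (y - 1)" using mod by (rule Suc.IH)
    ultimately show ?case
      using arc[of "y - 1" y] Suc.prems(1) by (auto intro: H.reachable_adj_trans)
  qed
  show ?thesis
  proof (rule H.strongly_connected_if_all_reachable[OF zero])
    fix y assume y: "y \<in> verts ?H"
    show "0 \<rightarrow>\<^sup>*\<^bsub>?H\<^esub> y"
    proof (cases "y = 0")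
      case False
      then have "y mod int p \<noteq> 0" using y by (auto simp: vertices_left)
      moreover have "y mod int p \<ge> 0" using p_ge_3 by simp
      ultimately have "y mod int p = int (Suc (nat (y mod int p - 1)))" by simp
      then show ?thesis using reach y by blast
    qed (use zero in simp)
  qed
qed

text \<open>Modulo \<open>m\<close>, the vertices that remain form a cycle of length \<open>m\<close> from which all multiples
  of \<open>p\<close> except \<open>0\<close> are deleted; the component of \<open>0\<close> lies between \<open>- p\<close> and \<open>p\<close>.\<close>

lemma not_strongly_connected_left:
  assumes "r \<noteq> 0"
  shows "\<not> strongly_connected (with_proj \<Gamma> \<restriction> (pverts \<Gamma> - nonzero_multiples p q))"
    (is "\<not> strongly_connected ?H")
proof
  assume sc: "strongly_connected ?H"
  interpret H: sym_digraph ?H by (rule sym_digraph_left)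
  have "int p * int p dvd m"
    using assms by (cases r) (simp_all add: m_def)
  moreover have "m > 0" using m_ge_3 by simp
  ultimately have "int p * int p \<le> m" by (rule zdvd_imp_le)
  moreover have "3 * int p \<le> int p * int p" using p_ge_3 by (intro mult_right_mono) auto
  \<comment> \<open>This separates p + 1 from the component of 0: for |k| < p the number p + 1 - k
    lies between 2 and 2 p, so \<open>m\<close> cannot divide it.\<close>
  ultimately have m: "3 * int p \<le> m" by linarith
  have "m \<le> int q" using m_dvd_q q_gt_1 by (intro zdvd_imp_le) auto
  moreover have "\<not> int p dvd int p + 1" using p_ge_3 by simp
  ultimately have "int p + 1 \<in> verts ?H" "0 \<in> verts ?H"
    using m p_ge_3 by (auto simp: vertices_left)
  then have "0 \<rightarrow>\<^sup>*\<^bsub>?H\<^esub> (int p + 1)" using sc by (auto simp: strongly_connected_def)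
  then have "\<exists>k. \<bar>k\<bar> < int p \<and> [int p + 1 = k] (mod m)"
  proof (induction rule: H.reachable_induct)
    case base
    show ?case using p_ge_3 by (intro exI[of _ 0]) simp
  next
    case (step x y)
    then obtain k where k: "\<bar>k\<bar> < int p" "[x = k] (mod m)" by blast
    have xy: "(x, y) \<in> parcs \<Gamma>" "y \<in> verts ?H"
      using step by (auto simp: arcs_ends_induce_with_proj)
    then have "[y = x + 1] (mod m) \<or> [y = x - 1] (mod m)" by (simp add: parcs_\<Gamma>)
    moreover have "[x + 1 = k + 1] (mod m)" "[x - 1 = k - 1] (mod m)"
      using k(2) by (auto intro: cong_add cong_diff)
    ultimately obtain k' where k': "\<bar>k'\<bar> \<le> int p" "[y = k'] (mod m)"
    proof (elim disjE)
      assume "[y = x + 1] (mod m)"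
      then have "[y = k + 1] (mod m)" using \<open>[x + 1 = k + 1] (mod m)\<close> by (rule cong_trans)
      then show thesis using k(1) by (intro that[of "k + 1"]) auto
    next
      assume "[y = x - 1] (mod m)"
      then have "[y = k - 1] (mod m)" using \<open>[x - 1 = k - 1] (mod m)\<close> by (rule cong_trans)
      then show thesis using k(1) by (intro that[of "k - 1"]) auto
    qed
    show ?case
    proof (cases "\<bar>k'\<bar> = int p")
      case True
      \<comment> \<open>At the barrier p or - p the vertex y is a multiple of p; the only one left
        is 0, for which the witness 0 serves.\<close>
      then have "int p dvd k'" by (metis dvd_abs_iff dvd_refl)
      then have "int p dvd y"
        using cong_dvd_iff[OF cong_dvd_modulus[OF k'(2) p_dvd_m]] by blast
      then have "y = 0" using xy(2) by (simp add: vertices_left)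
      then show ?thesis using p_ge_3 by (intro exI[of _ 0]) simp
    next
      case False
      then show ?thesis using k' by (intro exI[of _ k']) auto
    qed
  qed
  then obtain k where "\<bar>k\<bar> < int p" "m dvd int p + 1 - k" by (auto simp: cong_iff_dvd_diff)
  then show False using zdvd_imp_le[of m "int p + 1 - k"] m p_ge_3 by linarith
qed

lemma vertex_cut_iff: "vertex_cut \<Gamma> (nonzero_multiples p q) \<longleftrightarrow> r \<noteq> 0"
proof -
  have "nonzero_multiples p q \<subseteq> pverts \<Gamma>" by (auto simp: pverts_\<Gamma> nonzero_multiples_eq)
  moreover have "0 \<in> pverts \<Gamma>" "0 \<notin> nonzero_multiples p q"
    using q_gt_1 by (simp_all add: pverts_\<Gamma> nonzero_multiples_eq)
  then have "nonzero_multiples p q \<noteq> pverts \<Gamma>" by blast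
  ultimately have "vertex_cut \<Gamma> (nonzero_multiples p q) \<longleftrightarrow>
      \<not> strongly_connected (with_proj \<Gamma> \<restriction> (pverts \<Gamma> - nonzero_multiples p q))"
    by (rule vertex_cut_iff_not_strongly_connected[OF pair_pseudo_graph_\<Gamma> strongly_connected_\<Gamma>])
  then show ?thesis using strongly_connected_left not_strongly_connected_left by (cases "r = 0") simp_all
qed

end

theorem theorem3p1:
  fixes p e r q :: nat
  assumes "prime p" and "odd p" and "e \<ge> 3" and "q = p ^ e" and "r \<le> e - 1"
  shows "connected (with_proj (rotation_graph p e r))
    \<and> circulant (rotation_graph p e r)
    \<and> rotational (Zq q) (rotation_subgroup p e r)
    \<and> regular_of_degree (rotation_graph p e r) (2 * p ^ (e - r - 1))
    \<and> complete_rotation (Zq q) (rotation_subgroup p e r) (unit_action q (rotation_unit p e r))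
    \<and> (r < e - 1 \<longrightarrow>
         rotation_fixed_points (Zq q) (rotation_subgroup p e r)
           (unit_action q (rotation_unit p e r)) = nonzero_multiples p q)
    \<and> independent_set (rotation_graph p e r) (nonzero_multiples p q)
    \<and> (\<not> vertex_cut (rotation_graph p e r) (nonzero_multiples p q) \<longleftrightarrow> r = 0)"
proof -
  have "r < e" using assms(3,5) by linarith
  then interpret rotation p e r "p ^ e" "(int p - 1) ^ (p ^ r)" "int p ^ (r + 1)"
    using assms by unfold_locales simp_all
  show ?thesis
    unfolding assms(4) rotation_unit_eq unit_action_mod rotational_def
    by (intro conjI impI exI[of _ "unit_action (p ^ e) ((int p - 1) ^ (p ^ r))"]
        connected_\<Gamma> circulant_rotation_graph complete_rotation_u regular_\<Gamma> fixed_points_u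
        independent_nonzero_multiples)
      (simp_all add: vertex_cut_iff)
qed

end
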